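(* Assume that the confidence region assumption (CRA) (stated in the context) is satisfied at level $\varepsilon$ with bounds $r(1,\varepsilon),\dots,r(m,\varepsilon)$, and that the functions $f_1,\dots,f_m$ are orthogonal with respect to $\langle\cdot,\cdot\rangle_{GN}$ (i.e. $\langle e_i,e_j\rangle_{GN}=0$ for $i\ne j$). In this case the order of the projections in Iterative Feature Selection does not affect the obtained estimator, i.e. projecting $0$ successively on the regions $\mathcal{CR}(1,\varepsilon),\dots,\mathcal{CR}(m,\varepsilon)$ gives the same result in any order, so one can set $$\hat\alpha^{IFS}=\Pi^{GN}_{\mathcal{CR}(m,\varepsilon)}\cdots\Pi^{GN}_{\mathcal{CR}(1,\varepsilon)}0.$$ Then $$\hat\alpha^{IFS}=\hat\alpha^{L}=\hat\alpha^{DS}=\sum_{j=1}^m\operatorname{sgn}(\tilde\alpha_j)\Bigl(|\tilde\alpha_j|-\sqrt{r(j,\varepsilon)}\Bigr)_+e_j,$$ and $$P\left\{\|\hat\alpha^{L}-\overline\alpha\|_{GN}^2\le\inf_{S\subset\{1,\dots,m\}}\Bigl[\|\overline\alpha_S-\overline\alpha\|_{GN}^2+4\sum_{j\in S}r(j,\varepsilon)\Bigr]\right\}\ge 1-\varepsilon.$$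
   Context: Regression setting: one observes $n$ pairs $(X_i,Y_i)$ with $Y_i=f(X_i)+\xi_i$, and one is given a dictionary of functions $f_1,\dots,f_m$. Two cases are considered. (Deterministic design) $X_1,\dots,X_n$ are deterministic and the noises $\xi_i$ are i.i.d. with mean $0$ and finite second moment. Set $\|\alpha\|_{GN}^2=\|\alpha\|_n^2=\frac1n\sum_{i=1}^n\bigl[\sum_{j=1}^m\alpha_jf_j(X_i)\bigr]^2$ for $\alpha\in\mathbb{R}^m$, and let $\overline\alpha\in\mathbb{R}^m$ be a minimizer of $\alpha\mapsto\frac1n\sum_{i=1}^n\bigl[f(X_i)-\sum_{j=1}^m\alpha_jf_j(X_i)\bigr]^2$. (Random design) The pairs $(X_i,Y_i)$ are i.i.d., the marginal law $\mathbb{P}_X$ of $X_i$ is known, and the noise has mean $0$ and finite second moment. Set $\|\alpha\|_{GN}^2=\|\alpha\|_X^2=\mathbb{E}_{X\sim\mathbb{P}_X}\bigl\{\bigl[\sum_{j=1}^m\alpha_jf_j(X)\bigr]^2\bigr\}$, and let $\overline\alpha\in\mathbb{R}^m$ be a minimizer of $\alpha\mapsto\mathbb{E}_{X\sim\mathbb{P}_X}\bigl\{\bigl[f(X)-\sum_{j=1}^m\alpha_jf_j(X)\bigr]^2\bigr\}$. The statement applies in either case. $P$ is the distribution of the sample $(X_i,Y_i)_{i=1,\dots,n}$. $\langle\cdot,\cdot\rangle_{GN}$ is the scalar product associated with $\|\cdot\|_{GN}$ and $e_1,\dots,e_m$ is the canonical basis of $\mathbb{R}^m$. The dictionary is normalized: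 $\|e_j\|_{GN}=1$ for all $j$. For a closed convex set $\mathcal{C}\subset\mathbb{R}^m$, $\Pi^{GN}_{\mathcal{C}}(\alpha)=\arg\min_{\beta\in\mathcal{C}}\|\alpha-\beta\|_{GN}$. For $j\in\{1,\dots,m\}$: $\mathcal{M}_j=\{te_j:t\in\mathbb{R}\}$, $\overline\alpha^j=\Pi^{GN}_{\mathcal{M}_j}(\overline\alpha)$, $\tilde\alpha_j=\frac1n\sum_{i=1}^nf_j(X_i)Y_i$, $\hat\alpha^j=\tilde\alpha_je_j$. Assumption (CRA) at level $\varepsilon\in[0,1]$: there are (possibly data-dependent) bounds $r(j,\varepsilon)\ge 0$, $j=1,\dots,m$, such that $$P\Bigl[\forall j\in\{1,\dots,m\},\ \|\overline\alpha^j-\hat\alpha^j\|_{GN}^2\le r(j,\varepsilon)\Bigr]\ge 1-\varepsilon.$$ The confidence regions are $\mathcal{CR}(j,\varepsilon)=\{\alpha\in\mathbb{R}^m:\ \|\Pi^{GN}_{\mathcal{M}_j}(\alpha)-\hat\alpha^j\|_{GN}^2\le r(j,\varepsilon)\}=\{\alpha\in\mathbb{R}^m:\ |\langle\alpha,e_j\rangle_{GN}-\tilde\alpha_j|\le\sqrt{r(j,\varepsilon)}\}$. Estimators: the LASSO estimator is $\hat\alpha^{L}=\Pi^{GN}_{\bigcap_{j=1}^m\mathcal{CR}(j,\varepsilon)}(0)$; the Dantzig selector is $\hat\alpha^{DS}\in\arg\min\{\sum_{j=1}^m|\alpha_j|:\ \alpha\in\bigcap_{j=1}^m\mathcal{CR}(j,\varepsilon)\}$;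 Iterative Feature Selection (IFS) starts from $0$ and projects successively, with $\Pi^{GN}$, on single confidence regions $\mathcal{CR}(j,\varepsilon)$. For $S\subset\{1,\dots,m\}$: $\mathcal{M}_S=\{\alpha\in\mathbb{R}^m:\ j\notin S\Rightarrow\alpha_j=0\}$ and $\overline\alpha_S=\arg\min_{\alpha\in\mathcal{M}_S}\|\alpha-\overline\alpha\|_{GN}$. Also $x_+=\max(x,0)$ and $\operatorname{sgn}$ is the sign function. *)

theory Defs
  imports "HOL-Probability.Probability"
begin

section \<open>Observations and designs\<close>

text \<open>
  A coefficient vector lives in \<^typ>\<open>real^'m\<close>, so the finite type \<^typ>\<open>'m\<close> indexes the
  dictionary; observations are indexed by \<open>{1..n}\<close>. The noise \<open>\<xi>\<close> need not be independent of the
  design points in the random case: only its mean and its second moment are constrained.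
\<close>

type_synonym 'x data = "nat \<Rightarrow> 'x \<times> real"

definition sample :: "nat \<Rightarrow> (nat \<Rightarrow> 'w \<Rightarrow> 'x) \<Rightarrow> (nat \<Rightarrow> 'w \<Rightarrow> real) \<Rightarrow> 'w \<Rightarrow> 'x data" where
  "sample n X Y \<omega> = (\<lambda>i\<in>{1..n}. (X i \<omega>, Y i \<omega>))"

definition centered_L2 :: "'w measure \<Rightarrow> ('w \<Rightarrow> real) \<Rightarrow> bool" where
  "centered_L2 M Z \<longleftrightarrow>
     Z \<in> borel_measurable M \<and> integrable M (\<lambda>\<omega>. (Z \<omega>)\<^sup>2) \<and> (\<integral>\<omega>. Z \<omega> \<partial>M) = 0"

definition regression_model ::
  "'w measure \<Rightarrow> nat \<Rightarrow> (nat \<Rightarrow> 'w \<Rightarrow> 'x) \<Rightarrow> (nat \<Rightarrow> 'w \<Rightarrow> real) \<Rightarrow> (nat \<Rightarrow> 'w \<Rightarrow> real) \<Rightarrow> ('x \<Rightarrow> real) \<Rightarrow> bool"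
where
  "regression_model M n X Y \<xi> f \<longleftrightarrow>
     prob_space M \<and> n \<ge> 1 \<and>
     (\<forall>i\<in>{1..n}. centered_L2 M (\<xi> i)) \<and>
     (\<forall>i\<in>{1..n}. \<forall>\<omega>\<in>space M. Y i \<omega> = f (X i \<omega>) + \<xi> i \<omega>)"

definition deterministic_design ::
  "'w measure \<Rightarrow> nat \<Rightarrow> (nat \<Rightarrow> 'x) \<Rightarrow> (nat \<Rightarrow> 'w \<Rightarrow> 'x) \<Rightarrow> (nat \<Rightarrow> 'w \<Rightarrow> real) \<Rightarrow> (nat \<Rightarrow> 'w \<Rightarrow> real)
    \<Rightarrow> ('x \<Rightarrow> real) \<Rightarrow> bool"
where
  "deterministic_design M n x X Y \<xi> f \<longleftrightarrow>
     regression_model M n X Y \<xi> f \<and>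
     (\<forall>i\<in>{1..n}. \<forall>\<omega>\<in>space M. X i \<omega> = x i) \<and>
     prob_space.indep_vars M (\<lambda>_. borel) \<xi> {1..n} \<and>
     (\<forall>i\<in>{1..n}. \<forall>k\<in>{1..n}. distr M borel (\<xi> i) = distr M borel (\<xi> k))"

definition random_design ::
  "'w measure \<Rightarrow> nat \<Rightarrow> 'x measure \<Rightarrow> (nat \<Rightarrow> 'w \<Rightarrow> 'x) \<Rightarrow> (nat \<Rightarrow> 'w \<Rightarrow> real) \<Rightarrow> (nat \<Rightarrow> 'w \<Rightarrow> real)
    \<Rightarrow> ('x \<Rightarrow> real) \<Rightarrow> ('m \<Rightarrow> 'x \<Rightarrow> real) \<Rightarrow> bool"
where
  "random_design M n PX X Y \<xi> f \<phi> \<longleftrightarrow>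
     regression_model M n X Y \<xi> f \<and>
     f \<in> borel_measurable PX \<and> (\<forall>j. \<phi> j \<in> borel_measurable PX) \<and>
     (\<forall>i\<in>{1..n}. X i \<in> measurable M PX \<and> distr M PX (X i) = PX) \<and>
     prob_space.indep_vars M (\<lambda>_. PX \<Otimes>\<^sub>M borel) (\<lambda>i \<omega>. (X i \<omega>, Y i \<omega>)) {1..n} \<and>
     (\<forall>i\<in>{1..n}. \<forall>k\<in>{1..n}. distr M (PX \<Otimes>\<^sub>M borel) (\<lambda>\<omega>. (X i \<omega>, Y i \<omega>))
                            = distr M (PX \<Otimes>\<^sub>M borel) (\<lambda>\<omega>. (X k \<omega>, Y k \<omega>)))"


section \<open>The norm GN and the target coefficients\<close>

definition lin_comb :: "('m::finite \<Rightarrow> 'x \<Rightarrow> real) \<Rightarrow> real^'m \<Rightarrow> 'x \<Rightarrow> real" where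
  "lin_comb \<phi> \<alpha> x = (\<Sum>j\<in>UNIV. \<alpha> $ j * \<phi> j x)"

definition emp_norm :: "nat \<Rightarrow> (nat \<Rightarrow> 'x) \<Rightarrow> ('m::finite \<Rightarrow> 'x \<Rightarrow> real) \<Rightarrow> real^'m \<Rightarrow> real" where
  "emp_norm n x \<phi> \<alpha> = sqrt (1 / real n * (\<Sum>i=1..n. (lin_comb \<phi> \<alpha> (x i))\<^sup>2))"

definition emp_risk ::
  "nat \<Rightarrow> (nat \<Rightarrow> 'x) \<Rightarrow> ('x \<Rightarrow> real) \<Rightarrow> ('m::finite \<Rightarrow> 'x \<Rightarrow> real) \<Rightarrow> real^'m \<Rightarrow> real" where
  "emp_risk n x f \<phi> \<alpha> = 1 / real n * (\<Sum>i=1..n. (f (x i) - lin_comb \<phi> \<alpha> (x i))\<^sup>2)"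

text \<open>
  The Bochner integral is 0 on non-integrable functions. For a measurable dictionary the
  normalization \<open>L2_norm PX \<phi> (axis j 1) = 1\<close> forces every \<open>\<phi> j\<close> to be square integrable, so no
  such value occurs here.
\<close>

definition L2_norm :: "'x measure \<Rightarrow> ('m::finite \<Rightarrow> 'x \<Rightarrow> real) \<Rightarrow> real^'m \<Rightarrow> real" where
  "L2_norm PX \<phi> \<alpha> = sqrt (\<integral>x. (lin_comb \<phi> \<alpha> x)\<^sup>2 \<partial>PX)"

text \<open>
  Nothing makes \<open>f\<close> square integrable, so its risk takes values in \<open>[0, \<infinity>]\<close>.
\<close>

definition L2_risk ::
  "'x measure \<Rightarrow> ('x \<Rightarrow> real) \<Rightarrow> ('m::finite \<Rightarrow> 'x \<Rightarrow> real) \<Rightarrow> real^'m \<Rightarrow> ennreal" where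
  "L2_risk PX f \<phi> \<alpha> = (\<integral>\<^sup>+x. ennreal ((f x - lin_comb \<phi> \<alpha> x)\<^sup>2) \<partial>PX)"

text \<open>
  The scalar product associated with a Euclidean (semi)norm \<open>N\<close>, by polarization. The two lemmas
  below give the usual bilinear expressions.
\<close>

definition polar_inner :: "(real^'m::finite \<Rightarrow> real) \<Rightarrow> real^'m \<Rightarrow> real^'m \<Rightarrow> real" where
  "polar_inner N \<alpha> \<beta> = ((N (\<alpha> + \<beta>))\<^sup>2 - (N (\<alpha> - \<beta>))\<^sup>2) / 4"

lemma lin_comb_add: "lin_comb \<phi> (\<alpha> + \<beta>) x = lin_comb \<phi> \<alpha> x + lin_comb \<phi> \<beta> x"
  by (simp add: lin_comb_def algebra_simps sum.distrib)

lemma lin_comb_diff: "lin_comb \<phi> (\<alpha> - \<beta>) x = lin_comb \<phi> \<alpha> x - lin_comb \<phi> \<beta> x"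
  by (simp add: lin_comb_def algebra_simps sum_subtractf)

lemma polar_inner_emp_norm:
  "polar_inner (emp_norm n x \<phi>) \<alpha> \<beta>
     = 1 / real n * (\<Sum>i=1..n. lin_comb \<phi> \<alpha> (x i) * lin_comb \<phi> \<beta> (x i))"
proof -
  have sq: "(emp_norm n x \<phi> \<gamma>)\<^sup>2 = 1 / real n * (\<Sum>i=1..n. (lin_comb \<phi> \<gamma> (x i))\<^sup>2)" for \<gamma>
    by (simp add: emp_norm_def sum_nonneg)
  have "(emp_norm n x \<phi> (\<alpha> + \<beta>))\<^sup>2 - (emp_norm n x \<phi> (\<alpha> - \<beta>))\<^sup>2
      = 1 / real n * (\<Sum>i=1..n. 4 * (lin_comb \<phi> \<alpha> (x i) * lin_comb \<phi> \<beta> (x i)))"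
    unfolding sq right_diff_distrib[symmetric] sum_subtractf[symmetric]
    by (simp add: lin_comb_add lin_comb_diff power2_eq_square algebra_simps)
  then show ?thesis
    by (simp add: polar_inner_def sum_distrib_left[symmetric])
qed

lemma polar_inner_L2_norm:
  assumes "\<And>\<gamma>. integrable PX (\<lambda>x. (lin_comb \<phi> \<gamma> x)\<^sup>2)"
  shows "polar_inner (L2_norm PX \<phi>) \<alpha> \<beta> = (\<integral>x. lin_comb \<phi> \<alpha> x * lin_comb \<phi> \<beta> x \<partial>PX)"
proof -
  have sq: "(L2_norm PX \<phi> \<gamma>)\<^sup>2 = (\<integral>x. (lin_comb \<phi> \<gamma> x)\<^sup>2 \<partial>PX)" for \<gamma>
    by (simp add: L2_norm_def)
  have "(L2_norm PX \<phi> (\<alpha> + \<beta>))\<^sup>2 - (L2_norm PX \<phi> (\<alpha> - \<beta>))\<^sup>2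
      = (\<integral>x. (lin_comb \<phi> (\<alpha> + \<beta>) x)\<^sup>2 - (lin_comb \<phi> (\<alpha> - \<beta>) x)\<^sup>2 \<partial>PX)"
    unfolding sq using assms by (simp add: Bochner_Integration.integral_diff)
  also have "\<dots> = (\<integral>x. 4 * (lin_comb \<phi> \<alpha> x * lin_comb \<phi> \<beta> x) \<partial>PX)"
    by (intro Bochner_Integration.integral_cong)
       (simp_all add: lin_comb_add lin_comb_diff power2_eq_square algebra_simps)
  finally show ?thesis
    by (simp add: polar_inner_def)
qed


section \<open>Projections, confidence regions and estimators\<close>

text \<open>
  \<open>N\<close> is the norm GN, \<open>\<phi>\<close> the dictionary, \<open>d\<close> the observed data and \<open>r j \<epsilon> d\<close> the data-dependent
  bounds. \<open>arg_min\<close> picks one minimizer.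
\<close>

definition gn_proj :: "(real^'m::finite \<Rightarrow> real) \<Rightarrow> (real^'m) set \<Rightarrow> real^'m \<Rightarrow> real^'m" where
  "gn_proj N C \<alpha> = (ARG_MIN (\<lambda>\<beta>. N (\<alpha> - \<beta>)) \<beta>. \<beta> \<in> C)"

definition coord_line :: "'m::finite \<Rightarrow> (real^'m) set" where
  "coord_line j = range (\<lambda>t. t *\<^sub>R axis j 1)"

definition coord_subspace :: "'m::finite set \<Rightarrow> (real^'m) set" where
  "coord_subspace S = {\<alpha>. \<forall>j. j \<notin> S \<longrightarrow> \<alpha> $ j = 0}"

definition alpha_bar_on :: "(real^'m::finite \<Rightarrow> real) \<Rightarrow> real^'m \<Rightarrow> 'm set \<Rightarrow> real^'m" where
  "alpha_bar_on N abar S = (ARG_MIN (\<lambda>\<alpha>. N (\<alpha> - abar)) \<alpha>. \<alpha> \<in> coord_subspace S)"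

definition alpha_tilde :: "nat \<Rightarrow> ('m \<Rightarrow> 'x \<Rightarrow> real) \<Rightarrow> 'x data \<Rightarrow> 'm \<Rightarrow> real" where
  "alpha_tilde n \<phi> d j = 1 / real n * (\<Sum>i=1..n. \<phi> j (fst (d i)) * snd (d i))"

definition alpha_hat :: "nat \<Rightarrow> ('m::finite \<Rightarrow> 'x \<Rightarrow> real) \<Rightarrow> 'x data \<Rightarrow> 'm \<Rightarrow> real^'m" where
  "alpha_hat n \<phi> d j = alpha_tilde n \<phi> d j *\<^sub>R axis j 1"

text \<open>
  The assumption (CRA). Measurability of the bounds along the sample is part of it, so that the
  event below is an event. Probabilities under the law of the sample are written as probabilities
  of the corresponding events on the underlying probability space \<open>M\<close>.
\<close>

definition CRA ::
  "'w measure \<Rightarrow> ('w \<Rightarrow> 'x data) \<Rightarrow> (real^'m::finite \<Rightarrow> real) \<Rightarrow> nat \<Rightarrow> ('m \<Rightarrow> 'x \<Rightarrow> real) \<Rightarrow> real^'m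
    \<Rightarrow> ('m \<Rightarrow> real \<Rightarrow> 'x data \<Rightarrow> real) \<Rightarrow> real \<Rightarrow> bool"
where
  "CRA M D N n \<phi> abar r \<epsilon> \<longleftrightarrow>
     0 \<le> \<epsilon> \<and> \<epsilon> \<le> 1 \<and>
     (\<forall>j. (\<lambda>\<omega>. r j \<epsilon> (D \<omega>)) \<in> borel_measurable M) \<and>
     (\<forall>j. \<forall>\<omega>\<in>space M. 0 \<le> r j \<epsilon> (D \<omega>)) \<and>
     measure M {\<omega> \<in> space M. \<forall>j.
        (N (gn_proj N (coord_line j) abar - alpha_hat n \<phi> (D \<omega>) j))\<^sup>2 \<le> r j \<epsilon> (D \<omega>)} \<ge> 1 - \<epsilon>"

definition conf_region ::
  "(real^'m::finite \<Rightarrow> real) \<Rightarrow> nat \<Rightarrow> ('m \<Rightarrow> 'x \<Rightarrow> real) \<Rightarrow> ('m \<Rightarrow> real \<Rightarrow> 'x data \<Rightarrow> real) \<Rightarrow> real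
    \<Rightarrow> 'x data \<Rightarrow> 'm \<Rightarrow> (real^'m) set"
where
  "conf_region N n \<phi> r \<epsilon> d j =
     {\<alpha>. (N (gn_proj N (coord_line j) \<alpha> - alpha_hat n \<phi> d j))\<^sup>2 \<le> r j \<epsilon> d}"

definition lasso ::
  "(real^'m::finite \<Rightarrow> real) \<Rightarrow> nat \<Rightarrow> ('m \<Rightarrow> 'x \<Rightarrow> real) \<Rightarrow> ('m \<Rightarrow> real \<Rightarrow> 'x data \<Rightarrow> real) \<Rightarrow> real
    \<Rightarrow> 'x data \<Rightarrow> real^'m"
where
  "lasso N n \<phi> r \<epsilon> d = gn_proj N (\<Inter>j. conf_region N n \<phi> r \<epsilon> d j) 0"

text \<open>The Dantzig selector is any element of this set.\<close>

definition dantzig_selectors ::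
  "(real^'m::finite \<Rightarrow> real) \<Rightarrow> nat \<Rightarrow> ('m \<Rightarrow> 'x \<Rightarrow> real) \<Rightarrow> ('m \<Rightarrow> real \<Rightarrow> 'x data \<Rightarrow> real) \<Rightarrow> real
    \<Rightarrow> 'x data \<Rightarrow> (real^'m) set"
where
  "dantzig_selectors N n \<phi> r \<epsilon> d =
     {\<alpha>. is_arg_min (\<lambda>\<beta>. \<Sum>j\<in>UNIV. \<bar>\<beta> $ j\<bar>) (\<lambda>\<beta>. \<beta> \<in> (\<Inter>j. conf_region N n \<phi> r \<epsilon> d j)) \<alpha>}"

text \<open>
  An order of the projections is a list in which each index occurs exactly once; the head of the
  list is projected on first.
\<close>

definition enumerates :: "'m::finite list \<Rightarrow> bool" where
  "enumerates js \<longleftrightarrow> distinct js \<and> set js = UNIV"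

definition ifs ::
  "(real^'m::finite \<Rightarrow> real) \<Rightarrow> nat \<Rightarrow> ('m \<Rightarrow> 'x \<Rightarrow> real) \<Rightarrow> ('m \<Rightarrow> real \<Rightarrow> 'x data \<Rightarrow> real) \<Rightarrow> real
    \<Rightarrow> 'x data \<Rightarrow> 'm list \<Rightarrow> real^'m"
where
  "ifs N n \<phi> r \<epsilon> d js = fold (\<lambda>j \<alpha>. gn_proj N (conf_region N n \<phi> r \<epsilon> d j) \<alpha>) js 0"

definition soft_threshold ::
  "nat \<Rightarrow> ('m::finite \<Rightarrow> 'x \<Rightarrow> real) \<Rightarrow> ('m \<Rightarrow> real \<Rightarrow> 'x data \<Rightarrow> real) \<Rightarrow> real \<Rightarrow> 'x data \<Rightarrow> real^'m"
where
  "soft_threshold n \<phi> r \<epsilon> d =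
     (\<Sum>j\<in>UNIV. (sgn (alpha_tilde n \<phi> d j)
        * max (\<bar>alpha_tilde n \<phi> d j\<bar> - sqrt (r j \<epsilon> d)) 0) *\<^sub>R axis j 1)"

end

theory Submission
  imports Defs
begin

text \<open>
  An orthonormal dictionary turns the norm GN into the Euclidean norm of \<^typ>\<open>real^'m\<close>. The
  confidence regions are then slabs and their intersection is a box, on which the projection of 0,
  the successive projections and the minimization of the \<open>l\<^sup>1\<close> norm all split over the coordinates;
  in each coordinate the solution is the point of an interval closest to 0. When the interval contains
  the target coordinate, this point lies within \<open>2 * sqrt r\<close> of it (used for \<open>j \<in> S\<close>) and
  between it and 0 (used for \<open>j \<notin> S\<close>).
\<close>

section \<open>The design norm is the Euclidean norm\<close>

lemma lin_comb_scaleR: "lin_comb \<phi> (c *\<^sub>R \<alpha>) x = c * lin_comb \<phi> \<alpha> x"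
  by (simp add: lin_comb_def sum_distrib_left mult.assoc)

lemma lin_comb_axis: "lin_comb \<phi> (axis j 1) x = \<phi> j x"
proof -
  have "lin_comb \<phi> (axis j 1) x = (\<Sum>k\<in>UNIV. if k = j then \<phi> k x else 0)"
    unfolding lin_comb_def by (intro sum.cong) (auto simp: axis_def)
  then show ?thesis by simp
qed

text \<open>Bilinearity reduces \<open>B\<close> to its Gram matrix in the canonical basis, which is
  the identity. Of \<open>B\<close> only semidefiniteness is assumed; definiteness comes out with
  the conclusion. Leaving \<open>B\<close> abstract serves both designs.\<close>

lemma orthonormal_form_eq_norm:
  fixes N :: "real^'m::finite \<Rightarrow> real"
  assumes B: "bilinear B" and sym: "\<And>\<alpha> \<beta>. B \<alpha> \<beta> = B \<beta> \<alpha>"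
    and N: "\<And>\<alpha>. N \<alpha> = sqrt (B \<alpha> \<alpha>)" and nonneg: "\<And>\<alpha>. 0 \<le> B \<alpha> \<alpha>"
    and normalized: "\<And>j. N (axis j 1) = 1"
    and orthogonal: "\<And>i j. i \<noteq> j \<Longrightarrow> polar_inner N (axis i 1) (axis j 1) = 0"
  shows "N = norm"
proof
  fix \<alpha> :: "real^'m"
  have square: "(N \<gamma>)\<^sup>2 = B \<gamma> \<gamma>" for \<gamma>
    by (simp add: N nonneg)
  \<comment> \<open>By symmetry the polarized difference is 4 times
    \<open>B \<beta> \<gamma>\<close>, so the hypothesis on \<open>polar_inner\<close> gives the
    off-diagonal Gram entries.\<close>
  have "polar_inner N \<beta> \<gamma> = B \<beta> \<gamma>" for \<beta> \<gamma>
    using sym[of \<gamma> \<beta>]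
    by (simp add: polar_inner_def square bilinear_ladd[OF B] bilinear_radd[OF B]
        bilinear_lsub[OF B] bilinear_rsub[OF B])
  then have gram: "B (axis i 1) (axis j 1) = (if i = j then 1 else 0)" for i j
    using normalized[of i] orthogonal[of i j] by (cases "i = j") (simp_all add: N)
  have expand: "\<alpha> = (\<Sum>i\<in>UNIV. \<alpha> $ i *\<^sub>R axis i 1)"
    using basis_expansion[of \<alpha>] by (simp add: scalar_mult_eq_scaleR)
  have "B \<alpha> \<alpha> = B (\<Sum>i\<in>UNIV. \<alpha> $ i *\<^sub>R axis i 1) (\<Sum>j\<in>UNIV. \<alpha> $ j *\<^sub>R axis j 1)"
    using expand by simp
  also have "\<dots> = (\<Sum>(i, j)\<in>UNIV \<times> UNIV. B (\<alpha> $ i *\<^sub>R axis i 1) (\<alpha> $ j *\<^sub>R axis j 1))"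
    by (rule bilinear_sum[OF B])
  also have "\<dots> = (\<Sum>i\<in>UNIV. \<Sum>j\<in>UNIV. if i = j then \<alpha> $ i * \<alpha> $ j else 0)"
    unfolding sum.cartesian_product
    by (intro sum.cong)
       (auto simp: bilinear_lmul[OF B] bilinear_rmul[OF B] gram)
  also have "\<dots> = \<alpha> \<bullet> \<alpha>"
    by (simp add: inner_vec_def)
  finally show "N \<alpha> = norm \<alpha>"
    by (simp add: N norm_eq_sqrt_inner)
qed

lemma emp_norm_eq_norm:
  fixes \<phi> :: "'m::finite \<Rightarrow> 'x \<Rightarrow> real"
  assumes "\<And>j. emp_norm n x \<phi> (axis j 1) = 1"
    and "\<And>i j. i \<noteq> j \<Longrightarrow> polar_inner (emp_norm n x \<phi>) (axis i 1) (axis j 1) = 0"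
  shows "emp_norm n x \<phi> = norm"
proof (rule orthonormal_form_eq_norm)
  \<comment> \<open>The form \<open>B\<close> of the rule is instantiated here by the empirical
    scalar product.\<close>
  show "bilinear (\<lambda>\<alpha> \<beta>. 1 / real n * (\<Sum>i=1..n. lin_comb \<phi> \<alpha> (x i) * lin_comb \<phi> \<beta> (x i)))"
    unfolding bilinear_def
    by (intro allI conjI linearI; simp only: lin_comb_add lin_comb_scaleR real_scaleR_def)
       (simp_all add: algebra_simps sum.distrib sum_distrib_left)
  show "1 / real n * (\<Sum>i=1..n. lin_comb \<phi> \<alpha> (x i) * lin_comb \<phi> \<alpha> (x i)) \<ge> 0" for \<alpha>
    by (simp add: sum_nonneg)
qed (rule assms(1) | erule assms(2) | simp add: emp_norm_def power2_eq_square mult.commute)+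

text \<open>The product is dominated by the sum of the squares, since 2|gh| <= g^2 + h^2.\<close>

lemma integrable_mult_square:
  fixes g h :: "'x \<Rightarrow> real"
  assumes [measurable]: "g \<in> borel_measurable M" "h \<in> borel_measurable M"
    and "integrable M (\<lambda>x. (g x)\<^sup>2)" "integrable M (\<lambda>x. (h x)\<^sup>2)"
  shows "integrable M (\<lambda>x. g x * h x)"
proof (rule Bochner_Integration.integrable_bound)
  show "integrable M (\<lambda>x. (g x)\<^sup>2 + (h x)\<^sup>2)" using assms by simp
  have "\<bar>g x * h x\<bar> \<le> (g x)\<^sup>2 + (h x)\<^sup>2" for x
    using sum_squares_bound[of "\<bar>g x\<bar>" "\<bar>h x\<bar>"] zero_le_mult_iff[of "\<bar>g x\<bar>" "\<bar>h x\<bar>"]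
    unfolding abs_mult power2_abs by linarith
  then show "AE x in M. norm (g x * h x) \<le> norm ((g x)\<^sup>2 + (h x)\<^sup>2)" by simp
qed measurable

lemma L2_norm_eq_norm:
  fixes \<phi> :: "'m::finite \<Rightarrow> 'x \<Rightarrow> real"
  assumes meas: "\<And>j. \<phi> j \<in> borel_measurable PX"
    and normalized: "\<And>j. L2_norm PX \<phi> (axis j 1) = 1"
    and orthogonal: "\<And>i j. i \<noteq> j \<Longrightarrow> polar_inner (L2_norm PX \<phi>) (axis i 1) (axis j 1) = 0"
  shows "L2_norm PX \<phi> = norm"
proof (rule orthonormal_form_eq_norm)
  \<comment> \<open>The Bochner integral of a non-integrable function is 0, so a norm equal to 1
    forces square integrability.\<close>
  have "integrable PX (\<lambda>x. (\<phi> j x)\<^sup>2)" for j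
    using normalized[of j] not_integrable_integral_eq[of PX "\<lambda>x. (\<phi> j x)\<^sup>2"]
    by (auto simp: L2_norm_def lin_comb_axis)
  then have "integrable PX (\<lambda>x. \<phi> i x * \<phi> j x)" for i j
    by (intro integrable_mult_square meas)
  \<comment> \<open>Multiplying out two combinations leaves finitely many products of dictionary
    functions. Integrability of the whole is what makes the integral additive in each
    argument.\<close>
  then have "integrable PX (\<lambda>x. \<Sum>i\<in>UNIV. \<Sum>j\<in>UNIV. (\<alpha> $ i * \<beta> $ j) * (\<phi> i x * \<phi> j x))" for \<alpha> \<beta>
    by (intro Bochner_Integration.integrable_sum integrable_mult_right)
  then have [simp]: "integrable PX (\<lambda>x. lin_comb \<phi> \<alpha> x * lin_comb \<phi> \<beta> x)" for \<alpha> \<beta>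
    by (simp add: lin_comb_def sum_product mult_ac)
  show "bilinear (\<lambda>\<alpha> \<beta>. \<integral>x. lin_comb \<phi> \<alpha> x * lin_comb \<phi> \<beta> x \<partial>PX)"
    unfolding bilinear_def
    \<comment> \<open>The instance of \<open>mult.left_commute\<close> moves a scalar from between
      the two combinations to the front, where it can leave the integral.\<close>
    by (intro allI conjI linearI;
        simp only: lin_comb_add lin_comb_scaleR real_scaleR_def distrib_left distrib_right
          mult.assoc mult.left_commute[of "lin_comb \<phi> _ _" "_ :: real" "lin_comb \<phi> _ _"])
       (simp_all add: mult.left_commute)
qed (rule normalized | erule orthogonal | simp add: L2_norm_def power2_eq_square mult.commute)+


section \<open>Euclidean projections on boxes\<close>

text \<open>\<open>ARG_MIN\<close> is a choice among minimizers; a strict minimum turns it into a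
  definite value. The same criterion makes the set of Dantzig selectors a singleton.\<close>

lemma is_arg_min_strict_iff:
  fixes f :: "'a \<Rightarrow> 'b::order"
  assumes b: "P b" and less: "\<And>y. P y \<Longrightarrow> y \<noteq> b \<Longrightarrow> f b < f y"
  shows "is_arg_min f P y \<longleftrightarrow> y = b"
proof
  assume "is_arg_min f P y"
  then show "y = b"
    using b less[of y] by (auto simp: is_arg_min_def)
next
  assume "y = b"
  moreover have "\<not> f z < f b" if "P z" for z
    using less[OF that] by (cases "z = b") auto
  ultimately show "is_arg_min f P y"
    using b by (auto simp: is_arg_min_def)
qed

lemma norm_diff_vec_square:
  fixes \<alpha> \<beta> :: "real^'m::finite"
  shows "(norm (\<alpha> - \<beta>))\<^sup>2 = (\<Sum>j\<in>UNIV. (\<alpha> $ j - \<beta> $ j)\<^sup>2)"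
  by (simp only: power2_norm_eq_inner inner_vec_def) (simp add: power2_eq_square)

text \<open>The squared distance is a sum over coordinates, so it is minimized one coordinate at a
  time, and strictness in each coordinate makes the minimizer unique. The \<open>I j\<close> are
  arbitrary sets: \<open>UNIV\<close>, \<open>{0}\<close> and intervals all occur below.\<close>

lemma gn_proj_box:
  fixes \<alpha> b :: "real^'m::finite"
  assumes b: "\<And>j. b $ j \<in> I j"
    and closest: "\<And>j t. t \<in> I j \<Longrightarrow> t \<noteq> b $ j \<Longrightarrow> \<bar>\<alpha> $ j - b $ j\<bar> < \<bar>\<alpha> $ j - t\<bar>"
  shows "gn_proj norm {\<beta>. \<forall>j. \<beta> $ j \<in> I j} \<alpha> = b"
proof -
  have less: "norm (\<alpha> - b) < norm (\<alpha> - \<beta>)" if "\<forall>j. \<beta> $ j \<in> I j" "\<beta> \<noteq> b" for \<beta>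
  proof -
    from \<open>\<beta> \<noteq> b\<close> obtain k where k: "\<beta> $ k \<noteq> b $ k" by (auto simp: vec_eq_iff)
    have "(\<Sum>j\<in>UNIV. (\<alpha> $ j - b $ j)\<^sup>2) < (\<Sum>j\<in>UNIV. (\<alpha> $ j - \<beta> $ j)\<^sup>2)"
    \<comment> \<open>The inequality is weak in every coordinate and strict in coordinate
      \<open>k\<close>, where \<beta> leaves \<open>b\<close>.\<close>
    proof (rule sum_strict_mono_ex1)
      show "\<forall>j\<in>UNIV. (\<alpha> $ j - b $ j)\<^sup>2 \<le> (\<alpha> $ j - \<beta> $ j)\<^sup>2"
        using closest that(1) by (metis abs_le_square_iff less_eq_real_def)
      show "\<exists>j\<in>UNIV. (\<alpha> $ j - b $ j)\<^sup>2 < (\<alpha> $ j - \<beta> $ j)\<^sup>2"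
        using closest[of "\<beta> $ k" k] that(1) k by (metis UNIV_I abs_le_square_iff not_le)
    qed simp
    then show ?thesis
      unfolding norm_diff_vec_square[symmetric] by (rule power2_less_imp_less) simp
  qed
  have "is_arg_min (\<lambda>\<beta>. norm (\<alpha> - \<beta>)) (\<lambda>\<beta>. \<beta> \<in> {\<beta>. \<forall>j. \<beta> $ j \<in> I j}) \<beta> \<longleftrightarrow> \<beta> = b" for \<beta>
    by (rule is_arg_min_strict_iff) (use b less in auto)
  then show ?thesis
    by (simp add: gn_proj_def arg_min_def)
qed

text \<open>For s >= 0 this is the point of the interval [a - s, a + s] closest to t.\<close>

definition clip :: "real \<Rightarrow> real \<Rightarrow> real \<Rightarrow> real" where
  "clip a s t = max (a - s) (min (a + s) t)"

lemma clip_in: "0 \<le> s \<Longrightarrow> clip a s t \<in> {a - s..a + s}"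
  by (auto simp: clip_def)

lemma clip_closest:
  "0 \<le> s \<Longrightarrow> u \<in> {a - s..a + s} \<Longrightarrow> u \<noteq> clip a s t \<Longrightarrow> \<bar>t - clip a s t\<bar> < \<bar>t - u\<bar>"
  by (auto simp: clip_def max_def min_def split: if_splits)

text \<open>If |a| <= s, the interval contains 0; otherwise its point closest to 0 is the endpoint
  facing 0, at distance |a| - s from it. This is soft thresholding.\<close>

lemma clip_zero: "0 \<le> s \<Longrightarrow> clip a s 0 = sgn a * max (\<bar>a\<bar> - s) 0"
  by (auto simp: clip_def max_def min_def sgn_if)

section \<open>Lines, subspaces and confidence regions as boxes\<close>

lemma gn_proj_coord_line:
  fixes \<alpha> :: "real^'m::finite"
  shows "gn_proj norm (coord_line j) \<alpha> = \<alpha> $ j *\<^sub>R axis j 1"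
proof -
  \<comment> \<open>The line is a box that is free in coordinate \<open>j\<close> and pinned at 0 in
    the others.\<close>
  have eq: "coord_line j = {\<beta>. \<forall>k. \<beta> $ k \<in> (if k = j then UNIV else {0})}"
  proof (intro equalityI subsetI)
    fix \<beta> :: "real^'m" assume "\<beta> \<in> {\<beta>. \<forall>k. \<beta> $ k \<in> (if k = j then UNIV else {0})}"
    then have "\<beta> = \<beta> $ j *\<^sub>R axis j 1"
      by (auto simp: vec_eq_iff axis_def split: if_splits)
    then show "\<beta> \<in> coord_line j"
      unfolding coord_line_def by (rule range_eqI)
  qed (auto simp: coord_line_def axis_def)
  show ?thesis
    unfolding eq by (rule gn_proj_box) (auto simp: axis_def split: if_splits)
qed

lemma alpha_bar_on_norm: "alpha_bar_on norm \<alpha> S = (\<chi> j. if j \<in> S then \<alpha> $ j else 0)"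
proof -
  \<comment> \<open>\<open>alpha_bar_on\<close> subtracts in the opposite order; symmetry of the
    distance makes it a projection.\<close>
  have "alpha_bar_on norm \<alpha> S = gn_proj norm (coord_subspace S) \<alpha>"
    by (simp add: alpha_bar_on_def gn_proj_def norm_minus_commute)
  also have "coord_subspace S = {\<beta>. \<forall>j. \<beta> $ j \<in> (if j \<in> S then UNIV else {0})}"
    by (auto simp: coord_subspace_def)
  also have "gn_proj norm \<dots> \<alpha> = (\<chi> j. if j \<in> S then \<alpha> $ j else 0)"
    by (rule gn_proj_box) (auto split: if_splits)
  finally show ?thesis .
qed

text \<open>Both vectors lie on the same axis, so the distance is one-dimensional. For c < 0 both
  sides are false: \<open>sqrt\<close> is an odd function in HOL, and the interval becomes empty.
  The equivalence rewrites the confidence regions as well as the event of (CRA).\<close>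

lemma norm_coord_line_diff_le_iff:
  "(norm (gn_proj norm (coord_line j) \<alpha> - alpha_hat n \<phi> d j))\<^sup>2 \<le> c \<longleftrightarrow>
     \<alpha> $ j \<in> {alpha_tilde n \<phi> d j - sqrt c..alpha_tilde n \<phi> d j + sqrt c}"
proof -
  have "(norm (gn_proj norm (coord_line j) \<alpha> - alpha_hat n \<phi> d j))\<^sup>2 = (\<alpha> $ j - alpha_tilde n \<phi> d j)\<^sup>2"
    by (simp add: gn_proj_coord_line alpha_hat_def scaleR_left_diff_distrib[symmetric])
  moreover have "(\<alpha> $ j - alpha_tilde n \<phi> d j)\<^sup>2 \<le> c \<longleftrightarrow> \<bar>\<alpha> $ j - alpha_tilde n \<phi> d j\<bar> \<le> sqrt c"
    by (metis real_sqrt_abs real_sqrt_le_iff)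
  ultimately show ?thesis by (auto simp: abs_le_iff)
qed

lemma conf_region_norm:
  "conf_region norm n \<phi> r \<epsilon> d j =
     {\<alpha>. \<alpha> $ j \<in> {alpha_tilde n \<phi> d j - sqrt (r j \<epsilon> d)..alpha_tilde n \<phi> d j + sqrt (r j \<epsilon> d)}}"
  unfolding conf_region_def norm_coord_line_diff_le_iff ..

text \<open>A nonnegative bound makes \<open>clip_zero\<close> applicable, and the target formula
  becomes a coordinatewise projection of 0.\<close>

lemma soft_threshold_nth:
  assumes "0 \<le> r j \<epsilon> d"
  shows "soft_threshold n \<phi> r \<epsilon> d $ j = clip (alpha_tilde n \<phi> d j) (sqrt (r j \<epsilon> d)) 0"
proof -
  have "soft_threshold n \<phi> r \<epsilon> d $ j =
      (\<Sum>k\<in>UNIV. if k = j then sgn (alpha_tilde n \<phi> d k) * max (\<bar>alpha_tilde n \<phi> d k\<bar> - sqrt (r k \<epsilon> d)) 0 else 0)"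
    unfolding soft_threshold_def sum_component by (intro sum.cong) (auto simp: axis_def)
  then show ?thesis using assms by (simp add: clip_zero)
qed


section \<open>The estimators\<close>

text \<open>The slabs of all the axes intersect in a box, to which \<open>gn_proj_box\<close>
  applies with projected point 0.\<close>

lemma lasso_norm:
  fixes \<phi> :: "'m::finite \<Rightarrow> 'x \<Rightarrow> real"
  assumes "\<And>j. 0 \<le> r j \<epsilon> d"
  shows "lasso norm n \<phi> r \<epsilon> d = soft_threshold n \<phi> r \<epsilon> d"
proof -
  let ?I = "\<lambda>j. {alpha_tilde n \<phi> d j - sqrt (r j \<epsilon> d)..alpha_tilde n \<phi> d j + sqrt (r j \<epsilon> d)}"
  have s_nth: "soft_threshold n \<phi> r \<epsilon> d $ j = clip (alpha_tilde n \<phi> d j) (sqrt (r j \<epsilon> d)) 0" for j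
    by (rule soft_threshold_nth) (rule assms)
  have eq: "(\<Inter>j. conf_region norm n \<phi> r \<epsilon> d j) = {\<alpha>. \<forall>j. \<alpha> $ j \<in> ?I j}"
    unfolding conf_region_norm by blast
  show ?thesis
    unfolding lasso_def eq
  proof (rule gn_proj_box)
    fix j :: 'm and t assume "t \<in> ?I j" "t \<noteq> soft_threshold n \<phi> r \<epsilon> d $ j"
    then show "\<bar>0 $ j - soft_threshold n \<phi> r \<epsilon> d $ j\<bar> < \<bar>0 $ j - t\<bar>"
      unfolding s_nth zero_index by (intro clip_closest) (use assms in auto)
  qed (simp only: s_nth clip_in real_sqrt_ge_zero assms)
qed

text \<open>On the box each |\<beta>_j| has a unique minimizer, the point of the interval closest to
  0. Hence the l1 norm, although not strictly convex, has a single minimizer there.\<close>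

lemma dantzig_selectors_norm:
  fixes \<phi> :: "'m::finite \<Rightarrow> 'x \<Rightarrow> real"
  assumes r: "\<And>j. 0 \<le> r j \<epsilon> d"
  shows "dantzig_selectors norm n \<phi> r \<epsilon> d = {soft_threshold n \<phi> r \<epsilon> d}"
proof -
  let ?C = "\<Inter>j. conf_region norm n \<phi> r \<epsilon> d j" and ?s = "soft_threshold n \<phi> r \<epsilon> d"
  have s_nth: "?s $ j = clip (alpha_tilde n \<phi> d j) (sqrt (r j \<epsilon> d)) 0" for j
    by (rule soft_threshold_nth) (rule r)
  have s: "?s \<in> ?C"
    unfolding conf_region_norm INT_iff mem_Collect_eq s_nth by (intro ballI clip_in real_sqrt_ge_zero r)
  have coord: "\<bar>?s $ j\<bar> < \<bar>\<beta> $ j\<bar>" if "\<beta> \<in> ?C" "\<beta> $ j \<noteq> ?s $ j" for \<beta> j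
    using clip_closest[of "sqrt (r j \<epsilon> d)" "\<beta> $ j" "alpha_tilde n \<phi> d j" 0] that r
    unfolding conf_region_norm s_nth by simp
  have less: "(\<Sum>j\<in>UNIV. \<bar>?s $ j\<bar>) < (\<Sum>j\<in>UNIV. \<bar>\<beta> $ j\<bar>)" if "\<beta> \<in> ?C" "\<beta> \<noteq> ?s" for \<beta>
  proof (rule sum_strict_mono_ex1)
    show "\<forall>j\<in>UNIV. \<bar>?s $ j\<bar> \<le> \<bar>\<beta> $ j\<bar>"
      using coord[OF that(1)] by (metis less_eq_real_def)
    show "\<exists>j\<in>UNIV. \<bar>?s $ j\<bar> < \<bar>\<beta> $ j\<bar>"
      using coord[OF that(1)] that(2) by (metis UNIV_I vec_eq_iff)
  qed simp
  have "is_arg_min (\<lambda>\<beta>. \<Sum>j\<in>UNIV. \<bar>\<beta> $ j\<bar>) (\<lambda>\<beta>. \<beta> \<in> ?C) \<alpha> \<longleftrightarrow> \<alpha> = ?s" for \<alpha>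
    by (rule is_arg_min_strict_iff) (fact s, erule less)
  then show ?thesis
    by (simp add: dantzig_selectors_def)
qed

text \<open>A slab is a box with \<open>UNIV\<close> in every coordinate but one, so projecting on
  it leaves the other coordinates untouched. This is why the projections commute.\<close>

lemma gn_proj_conf_region:
  fixes \<phi> :: "'m::finite \<Rightarrow> 'x \<Rightarrow> real"
  assumes "0 \<le> r j \<epsilon> d"
  shows "gn_proj norm (conf_region norm n \<phi> r \<epsilon> d j) \<alpha> =
    (\<chi> k. if k = j then clip (alpha_tilde n \<phi> d k) (sqrt (r k \<epsilon> d)) (\<alpha> $ k) else \<alpha> $ k)"
proof -
  let ?I = "\<lambda>k. if k = j then
     {alpha_tilde n \<phi> d k - sqrt (r k \<epsilon> d)..alpha_tilde n \<phi> d k + sqrt (r k \<epsilon> d)} else UNIV"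
  have eq: "conf_region norm n \<phi> r \<epsilon> d j = {\<alpha>. \<forall>k. \<alpha> $ k \<in> ?I k}"
    unfolding conf_region_norm by auto
  have s: "0 \<le> sqrt (r j \<epsilon> d)" using assms by simp
  show ?thesis
    unfolding eq
  proof (rule gn_proj_box)
    show "(\<chi> k. if k = j then clip (alpha_tilde n \<phi> d k) (sqrt (r k \<epsilon> d)) (\<alpha> $ k) else \<alpha> $ k) $ k \<in> ?I k" for k
      using clip_in[OF s] by simp
  next
    fix k t assume "t \<in> ?I k"
      and "t \<noteq> (\<chi> k. if k = j then clip (alpha_tilde n \<phi> d k) (sqrt (r k \<epsilon> d)) (\<alpha> $ k) else \<alpha> $ k) $ k"
    then show "\<bar>\<alpha> $ k - (\<chi> k. if k = j then clip (alpha_tilde n \<phi> d k) (sqrt (r k \<epsilon> d)) (\<alpha> $ k) else \<alpha> $ k) $ k\<bar>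
        < \<bar>\<alpha> $ k - t\<bar>"
      using clip_closest[OF s, of t "alpha_tilde n \<phi> d j" "\<alpha> $ j"] by (cases "k = j") simp_all
  qed
qed

lemma ifs_norm:
  fixes \<phi> :: "'m::finite \<Rightarrow> 'x \<Rightarrow> real"
  assumes r: "\<And>j. 0 \<le> r j \<epsilon> d" and "enumerates js"
  shows "ifs norm n \<phi> r \<epsilon> d js = soft_threshold n \<phi> r \<epsilon> d"
proof -
  let ?c = "\<lambda>k. clip (alpha_tilde n \<phi> d k) (sqrt (r k \<epsilon> d))"
  have step: "gn_proj norm (conf_region norm n \<phi> r \<epsilon> d j) \<alpha> =
      (\<chi> k. if k = j then ?c k (\<alpha> $ k) else \<alpha> $ k)" for j \<alpha>
    by (rule gn_proj_conf_region) (rule r)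
  \<comment> \<open>The starting vector is general because the induction absorbs the first
    projection into it. Distinctness keeps coordinate \<open>j\<close> from being clipped again by
    the tail.\<close>
  have fold: "fold (\<lambda>j \<alpha>. gn_proj norm (conf_region norm n \<phi> r \<epsilon> d j) \<alpha>) js \<alpha> =
      (\<chi> k. if k \<in> set js then ?c k (\<alpha> $ k) else \<alpha> $ k)" if "distinct js" for js \<alpha>
    using that
  proof (induction js arbitrary: \<alpha>)
    case (Cons j js)
    then show ?case by (auto simp: step intro!: vec_eq_iff[THEN iffD2])
  qed simp
  have "soft_threshold n \<phi> r \<epsilon> d $ k = ?c k 0" for k
    by (rule soft_threshold_nth) (rule r)
  then show ?thesis
    using assms(2) by (simp add: ifs_def enumerates_def fold vec_eq_iff)
qed

section \<open>The risk bound, coordinate by coordinate\<close>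

lemma soft_threshold_risk_bound:
  fixes \<phi> :: "'m::finite \<Rightarrow> 'x \<Rightarrow> real"
  assumes r: "\<And>j. 0 \<le> r j \<epsilon> d"
    and cra: "\<And>j. \<alpha> $ j \<in> {alpha_tilde n \<phi> d j - sqrt (r j \<epsilon> d)..alpha_tilde n \<phi> d j + sqrt (r j \<epsilon> d)}"
  shows "(norm (soft_threshold n \<phi> r \<epsilon> d - \<alpha>))\<^sup>2
    \<le> (norm (alpha_bar_on norm \<alpha> S - \<alpha>))\<^sup>2 + 4 * (\<Sum>j\<in>S. r j \<epsilon> d)"
proof -
  let ?s = "soft_threshold n \<phi> r \<epsilon> d"
  have inside: "\<bar>?s $ j - \<alpha> $ j\<bar> \<le> 2 * sqrt (r j \<epsilon> d)" for j
    using cra[of j] clip_in[of "sqrt (r j \<epsilon> d)" "alpha_tilde n \<phi> d j" 0] r[of j]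
    by (simp add: soft_threshold_nth abs_le_iff)
  \<comment> \<open>If the interval contains 0, the estimate is 0; otherwise it is the endpoint
    nearer to 0 and has the same sign as the target.\<close>
  have shrink: "\<bar>?s $ j - \<alpha> $ j\<bar> \<le> \<bar>\<alpha> $ j\<bar>" for j
    using cra[of j] r[of j]
    by (auto simp: soft_threshold_nth clip_def max_def min_def split: if_splits)
  \<comment> \<open>For \<open>j \<in> S\<close> the first square on the right vanishes and
    \<open>inside\<close> squared gives the constant 4; for \<open>j \<notin> S\<close> the claim is
    \<open>shrink\<close> squared.\<close>
  have "(?s $ j - \<alpha> $ j)\<^sup>2 \<le> ((if j \<in> S then \<alpha> $ j else 0) - \<alpha> $ j)\<^sup>2 + 4 * (if j \<in> S then r j \<epsilon> d else 0)" for j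
    using power_mono[OF inside[of j], of 2] power_mono[OF shrink[of j], of 2] r[of j]
    by (simp add: power_mult_distrib)
  then have "(\<Sum>j\<in>UNIV. (?s $ j - \<alpha> $ j)\<^sup>2) \<le>
     (\<Sum>j\<in>UNIV. ((if j \<in> S then \<alpha> $ j else 0) - \<alpha> $ j)\<^sup>2 + 4 * (if j \<in> S then r j \<epsilon> d else 0))"
    by (rule sum_mono)
  also have "\<dots> = (\<Sum>j\<in>UNIV. ((if j \<in> S then \<alpha> $ j else 0) - \<alpha> $ j)\<^sup>2) + 4 * (\<Sum>j\<in>S. r j \<epsilon> d)"
    by (simp add: sum.distrib sum_distrib_left[symmetric] sum.If_cases)
  finally show ?thesis
    by (simp only: norm_diff_vec_square alpha_bar_on_norm vec_lambda_beta)
qed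


section \<open>Measurability along the sample\<close>

text \<open>Measurability is asked of the product as a whole, since in the deterministic design the
  space of design points carries no sigma-algebra.\<close>

lemma alpha_tilde_measurable:
  assumes "\<And>i. i \<in> {1..n} \<Longrightarrow> (\<lambda>\<omega>. \<phi> j (X i \<omega>) * Y i \<omega>) \<in> borel_measurable M"
  shows "(\<lambda>\<omega>. alpha_tilde n \<phi> (sample n X Y \<omega>) j) \<in> borel_measurable M"
proof -
  have "(\<lambda>\<omega>. 1 / real n * (\<Sum>i=1..n. \<phi> j (X i \<omega>) * Y i \<omega>)) \<in> borel_measurable M"
    by (rule borel_measurable_times[OF borel_measurable_const borel_measurable_sum]) (rule assms)
  moreover have "alpha_tilde n \<phi> (sample n X Y \<omega>) j = 1 / real n * (\<Sum>i=1..n. \<phi> j (X i \<omega>) * Y i \<omega>)" for \<omega>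
    unfolding alpha_tilde_def sample_def
    by (intro arg_cong2[where f="(*)"] sum.cong refl) simp_all
  ultimately show ?thesis by simp
qed

lemma alpha_tilde_measurable_deterministic:
  assumes "deterministic_design M n x X Y \<xi> f"
  shows "(\<lambda>\<omega>. alpha_tilde n \<phi> (sample n X Y \<omega>) j) \<in> borel_measurable M"
proof (rule alpha_tilde_measurable)
  fix i assume i: "i \<in> {1..n}"
  with assms have [measurable]: "\<xi> i \<in> borel_measurable M"
    by (simp add: deterministic_design_def regression_model_def centered_L2_def)
  \<comment> \<open>With fixed design points the product is an affine function of the noise,
    whatever \<phi> and \<open>f\<close> are. The equations for \<open>X i\<close> and
    \<open>Y i\<close> hold on \<open>space M\<close>, which suffices to transfer
    measurability.\<close>
  have "(\<lambda>\<omega>. \<phi> j (x i) * (f (x i) + \<xi> i \<omega>)) \<in> borel_measurable M"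
    by measurable
  then show "(\<lambda>\<omega>. \<phi> j (X i \<omega>) * Y i \<omega>) \<in> borel_measurable M"
    by (rule measurable_cong[THEN iffD1, rotated])
       (use assms i in \<open>auto simp: deterministic_design_def regression_model_def\<close>)
qed

lemma alpha_tilde_measurable_random:
  assumes "random_design M n PX X Y \<xi> f \<phi>"
  shows "(\<lambda>\<omega>. alpha_tilde n \<phi> (sample n X Y \<omega>) j) \<in> borel_measurable M"
proof (rule alpha_tilde_measurable)
  fix i assume i: "i \<in> {1..n}"
  have "prob_space M"
    using assms by (simp add: random_design_def regression_model_def)
  \<comment> \<open>\<open>indep_vars\<close> contains the measurability of each pair, and thus that
    of its components.\<close>
  then have [measurable]: "(\<lambda>\<omega>. (X i \<omega>, Y i \<omega>)) \<in> M \<rightarrow>\<^sub>M PX \<Otimes>\<^sub>M borel" "\<phi> j \<in> borel_measurable PX"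
    using assms i by (auto simp: random_design_def prob_space.indep_vars_def)
  have "(\<lambda>\<omega>. \<phi> j (fst (X i \<omega>, Y i \<omega>)) * snd (X i \<omega>, Y i \<omega>)) \<in> borel_measurable M"
    by (intro borel_measurable_times measurable_compose[OF _ measurable_snd]
        measurable_compose[OF measurable_compose[OF _ measurable_fst]]) measurable
  then show "(\<lambda>\<omega>. \<phi> j (X i \<omega>) * Y i \<omega>) \<in> borel_measurable M"
    by simp
qed


section \<open>Equality of the estimators and the risk bound\<close>

theorem theorem3p2:
  fixes M :: "'w measure" and PX :: "'x measure" and n :: nat
    and x :: "nat \<Rightarrow> 'x" and X :: "nat \<Rightarrow> 'w \<Rightarrow> 'x" and Y \<xi> :: "nat \<Rightarrow> 'w \<Rightarrow> real"
    and f :: "'x \<Rightarrow> real" and \<phi> :: "'m::finite \<Rightarrow> 'x \<Rightarrow> real"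
    and N :: "real^'m \<Rightarrow> real" and abar :: "real^'m"
    and r :: "'m \<Rightarrow> real \<Rightarrow> 'x data \<Rightarrow> real" and \<epsilon> :: real
  assumes design:
    "(deterministic_design M n x X Y \<xi> f \<and> N = emp_norm n x \<phi> \<and>
        is_arg_min (emp_risk n x f \<phi>) (\<lambda>_. True) abar) \<or>
     (random_design M n PX X Y \<xi> f \<phi> \<and> N = L2_norm PX \<phi> \<and>
        is_arg_min (L2_risk PX f \<phi>) (\<lambda>_. True) abar)"
    and normalized: "\<forall>j. N (axis j 1) = 1"
    and cra: "CRA M (sample n X Y) N n \<phi> abar r \<epsilon>"
    and orthogonal: "\<forall>i j. i \<noteq> j \<longrightarrow> polar_inner N (axis i 1) (axis j 1) = 0"
  shows "(\<forall>\<omega>\<in>space M. let d = sample n X Y \<omega> in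
            (\<forall>js js'. enumerates js \<and> enumerates js' \<longrightarrow>
               ifs N n \<phi> r \<epsilon> d js = ifs N n \<phi> r \<epsilon> d js') \<and>
            (\<forall>js. enumerates js \<longrightarrow> ifs N n \<phi> r \<epsilon> d js = lasso N n \<phi> r \<epsilon> d) \<and>
            dantzig_selectors N n \<phi> r \<epsilon> d = {lasso N n \<phi> r \<epsilon> d} \<and>
            lasso N n \<phi> r \<epsilon> d = soft_threshold n \<phi> r \<epsilon> d)
       \<and> measure M {\<omega> \<in> space M.
            (N (lasso N n \<phi> r \<epsilon> (sample n X Y \<omega>) - abar))\<^sup>2
              \<le> (INF S\<in>Pow UNIV. (N (alpha_bar_on N abar S - abar))\<^sup>2
                                   + 4 * (\<Sum>j\<in>S. r j \<epsilon> (sample n X Y \<omega>)))} \<ge> 1 - \<epsilon>"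
proof -
  have M: "prob_space M"
    using design by (auto simp: deterministic_design_def random_design_def regression_model_def)
  have N: "N = norm"
    using design normalized orthogonal emp_norm_eq_norm[of n x \<phi>] L2_norm_eq_norm[of \<phi> PX]
    by (auto simp: random_design_def)
  have tilde [measurable]: "(\<lambda>\<omega>. alpha_tilde n \<phi> (sample n X Y \<omega>) j) \<in> borel_measurable M" for j
    using design
    by (elim disjE conjE) (erule alpha_tilde_measurable_deterministic alpha_tilde_measurable_random)+
  have r_meas [measurable]: "(\<lambda>\<omega>. r j \<epsilon> (sample n X Y \<omega>)) \<in> borel_measurable M" for j
    using cra by (simp add: CRA_def)
  have r: "0 \<le> r j \<epsilon> (sample n X Y \<omega>)" if "\<omega> \<in> space M" for \<omega> j
    using cra that by (simp add: CRA_def)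
  let ?good = "{\<omega> \<in> space M. \<forall>j. (N (gn_proj N (coord_line j) abar - alpha_hat n \<phi> (sample n X Y \<omega>) j))\<^sup>2
      \<le> r j \<epsilon> (sample n X Y \<omega>)}"
  let ?rhs = "\<lambda>\<omega> S. (N (alpha_bar_on N abar S - abar))\<^sup>2 + 4 * (\<Sum>j\<in>S. r j \<epsilon> (sample n X Y \<omega>))"
  let ?event = "{\<omega> \<in> space M. (N (lasso N n \<phi> r \<epsilon> (sample n X Y \<omega>) - abar))\<^sup>2
      \<le> (INF S\<in>Pow UNIV. ?rhs \<omega> S)}"
  \<comment> \<open>The LASSO is defined by a choice, so measurability is read off its explicit
    clipped form. The two agree on \<open>space M\<close>, where the bounds are nonnegative.\<close>
  have event_eq: "?event = {\<omega> \<in> space M. \<forall>S.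
      (\<Sum>j\<in>UNIV. (clip (alpha_tilde n \<phi> (sample n X Y \<omega>) j) (sqrt (r j \<epsilon> (sample n X Y \<omega>))) 0 - abar $ j)\<^sup>2)
        \<le> ?rhs \<omega> S}"
  proof (rule Collect_cong, rule conj_cong[OF refl])
    fix \<omega> assume "\<omega> \<in> space M"
    note r = r[OF this]
    have s_nth: "soft_threshold n \<phi> r \<epsilon> (sample n X Y \<omega>) $ j =
        clip (alpha_tilde n \<phi> (sample n X Y \<omega>) j) (sqrt (r j \<epsilon> (sample n X Y \<omega>))) 0" for j
      by (rule soft_threshold_nth) (rule r)
    have lasso: "lasso norm n \<phi> r \<epsilon> (sample n X Y \<omega>) = soft_threshold n \<phi> r \<epsilon> (sample n X Y \<omega>)"
      by (rule lasso_norm) (rule r)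
    show "(N (lasso N n \<phi> r \<epsilon> (sample n X Y \<omega>) - abar))\<^sup>2 \<le> (INF S\<in>Pow UNIV. ?rhs \<omega> S) \<longleftrightarrow>
      (\<forall>S. (\<Sum>j\<in>UNIV. (clip (alpha_tilde n \<phi> (sample n X Y \<omega>) j) (sqrt (r j \<epsilon> (sample n X Y \<omega>))) 0 - abar $ j)\<^sup>2)
        \<le> ?rhs \<omega> S)"
      \<comment> \<open>The subsets of a finite type form a finite nonempty family, so the infimum
        is over a set bounded below, and lying below it means lying below each member.\<close>
      unfolding N lasso norm_diff_vec_square[of "soft_threshold _ _ _ _ _"]
        s_nth
      by (subst le_cINF_iff) auto
  qed
  \<comment> \<open>Monotonicity of \<open>measure\<close> requires the larger set to be
    measurable.\<close>
  have "?event \<in> sets M"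
    unfolding event_eq clip_def by measurable
  moreover have "?good \<subseteq> ?event"
  proof
    fix \<omega> assume "\<omega> \<in> ?good"
    then have \<omega>: "\<omega> \<in> space M" and cra: "abar $ j \<in>
       {alpha_tilde n \<phi> (sample n X Y \<omega>) j - sqrt (r j \<epsilon> (sample n X Y \<omega>))..
        alpha_tilde n \<phi> (sample n X Y \<omega>) j + sqrt (r j \<epsilon> (sample n X Y \<omega>))}" for j
      unfolding N norm_coord_line_diff_le_iff by blast+
    have lasso: "lasso norm n \<phi> r \<epsilon> (sample n X Y \<omega>) = soft_threshold n \<phi> r \<epsilon> (sample n X Y \<omega>)"
      by (rule lasso_norm) (rule r[OF \<omega>])
    \<comment> \<open>On the good event the bound holds for all \<open>S\<close> at once, hence for
      the infimum.\<close>
    have "(N (lasso N n \<phi> r \<epsilon> (sample n X Y \<omega>) - abar))\<^sup>2 \<le> (INF S\<in>Pow UNIV. ?rhs \<omega> S)"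
      unfolding N lasso
      by (intro cINF_greatest soft_threshold_risk_bound r[OF \<omega>] cra) simp
    with \<omega> show "\<omega> \<in> ?event" by blast
  qed
  ultimately have "measure M ?good \<le> measure M ?event"
    using M by (intro finite_measure.finite_measure_mono) (simp_all add: prob_space_def)
  moreover have "1 - \<epsilon> \<le> measure M ?good"
    using cra unfolding CRA_def by blast
  ultimately have "1 - \<epsilon> \<le> measure M ?event" by linarith
  \<comment> \<open>The identities between the estimators hold at every outcome, also outside the
    good event; they rest on the nonnegativity of the bounds.\<close>
  moreover have "let d = sample n X Y \<omega> in
            (\<forall>js js'. enumerates js \<and> enumerates js' \<longrightarrow>
               ifs N n \<phi> r \<epsilon> d js = ifs N n \<phi> r \<epsilon> d js') \<and>
            (\<forall>js. enumerates js \<longrightarrow> ifs N n \<phi> r \<epsilon> d js = lasso N n \<phi> r \<epsilon> d) \<and>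
            dantzig_selectors N n \<phi> r \<epsilon> d = {lasso N n \<phi> r \<epsilon> d} \<and>
            lasso N n \<phi> r \<epsilon> d = soft_threshold n \<phi> r \<epsilon> d" if "\<omega> \<in> space M" for \<omega>
    using r[OF that] by (simp add: Let_def N lasso_norm dantzig_selectors_norm ifs_norm)
  ultimately show ?thesis by blast
qed

end
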